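(* As $s\to 1^+$, $$\sum_{n=2}^\infty \frac{1}{(n\log n)^s} = -\log(s-1) +C_{1,1}-\gamma+O\big((s-1)\log^2(s-1)\big),$$ where $C_{1,1}$ is the constant $C_{1,1}=\lim_{N\to\infty}\Big(\sum_{k=2}^{N-1}\frac{1}{k\log k}-\log(\log N)\Big)$.
   Context: $\gamma$ is Euler's constant. *)

theory Defs
  imports "HOL-Analysis.Analysis" "HOL-Library.Landau_Symbols"
begin

definition C11_seq :: "nat \<Rightarrow> real" where
  "C11_seq N = (\<Sum>k\<in>{2..<N}. 1 / (real k * ln (real k))) - ln (ln (real N))"

definition C11 :: real where
  "C11 = lim C11_seq"

definition bertrand_term :: "real \<Rightarrow> nat \<Rightarrow> real" where
  "bertrand_term s n = 1 / (real n * ln (real n)) powr s"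

end

theory Submission
  imports Defs "HOL-Real_Asymp.Real_Asymp"
begin

text \<open>
  Write \<open>s = 1 + e\<close> and \<open>f e x = 1 / (x ln x) powr (1 + e)\<close>. The sum is split into the
  integral of \<open>f e\<close> over \<open>[2, \<infinity>)\<close> and the difference between sum and integral. The difference
  contributes \<open>C11\<close>, the integral contributes \<open>- ln e\<close> and \<open>- \<gamma>\<close>, and \<open>ln (ln 2)\<close> cancels.

  \<^item> The difference is the sum over \<open>n \<ge> 2\<close> of \<open>f e n - \<integral> f e\<close> over \<open>[n, n + 1]\<close>. This series still
    converges at \<open>e = 0\<close>, where its value is \<open>C11 + ln (ln 2)\<close> because \<open>ln (ln x)\<close> is an
    antiderivative of \<open>f 0\<close>. Its terms depend on \<open>e\<close> in a Lipschitz way: two applications of the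
    mean value theorem bound the change of the \<open>n\<close>-th term by the supremum of
    \<open>(f e - f 0)'\<close> on \<open>[n, n + 1]\<close>, which is at most \<open>6 e / n\<^sup>2\<close>. So the difference is
    \<open>C11 + ln (ln 2) + O(e)\<close> (lemmas \<open>mvt_unit_step\<close>, \<open>bertrand_minus_log_deriv\<close>,
    \<open>defect_antideriv_close\<close>).

  \<^item> The integral produces the logarithm and Euler's constant. Integrating by parts once and
    substituting \<open>t = e ln x\<close> gives an antiderivative in terms of the lower incomplete Gamma
    function with parameter \<open>1 - e\<close> (lemma \<open>antideriv_deriv\<close>), hence
    \<open>((2 ln 2) powr (-e) - e powr e * Gamma (1 - e)) / e\<close> plus an incomplete Gamma term that tends
    to \<open>ln 2\<close>. The expansions \<open>Gamma (1 - e) = 1 + \<gamma> e + O(e\<^sup>2)\<close> and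
    \<open>e powr e = 1 + e ln e + O(e\<^sup>2 (ln e)\<^sup>2)\<close> turn this into
    \<open>- ln e - \<gamma> - ln (ln 2) + O(e (ln e)\<^sup>2)\<close> (lemma \<open>integral_expansion\<close>). The second expansion is
    what causes the squared logarithm in the error term.

  Working with explicit antiderivatives makes every integral over \<open>[n, n + 1]\<close> or \<open>[2, \<infinity>)\<close> a
  difference of values, so that the only integral in the proof is the incomplete Gamma function.
\<close>

section \<open>Mean value estimates for the terms\<close>

text \<open>
  The quantity \<open>F (a + 1) - F a\<close> is \<open>f\<close> at some intermediate point \<open>z\<close>, and \<open>f a - f z\<close> is again
  controlled by a derivative; this replaces an estimate of \<open>\<integral> f\<close> over the unit interval.
\<close>

lemma mvt_unit_step:
  fixes F f f' :: "real \<Rightarrow> real"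
  assumes F: "\<And>x. a \<le> x \<Longrightarrow> x \<le> a + 1 \<Longrightarrow> (F has_real_derivative f x) (at x)"
    and f: "\<And>x. a \<le> x \<Longrightarrow> x \<le> a + 1 \<Longrightarrow> (f has_real_derivative f' x) (at x)"
    and B: "\<And>x. a \<le> x \<Longrightarrow> x \<le> a + 1 \<Longrightarrow> \<bar>f' x\<bar> \<le> B"
  shows "\<bar>f a - (F (a + 1) - F a)\<bar> \<le> B"
proof -
  obtain z where z: "a < z" "z < a + 1" "F (a + 1) - F a = (a + 1 - a) * f z"
    using MVT2[of a "a + 1" F f] F by auto
  obtain w where w: "a < w" "w < z" "f z - f a = (z - a) * f' w"
    using MVT2[of a z f f'] f z by auto
  have "\<bar>f a - (F (a + 1) - F a)\<bar> = (z - a) * \<bar>f' w\<bar>"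
  proof -
    have "f a - (F (a + 1) - F a) = - ((z - a) * f' w)" using z w by simp
    then show ?thesis using z by (simp add: abs_mult)
  qed
  also have "\<dots> \<le> 1 * B"
    by (rule mult_mono) (use z w B[of w] in auto)
  finally show ?thesis by simp
qed

lemma ln_bounds:
  fixes x :: real
  assumes "x \<ge> 2"
  shows "1 \<le> 2 * ln x" "x * ln x \<ge> 1" "ln (x * ln x) \<le> 2 * ln x"
proof -
  have "ln 2 \<le> ln x" using assms by simp
  then have l: "ln x \<ge> 2/3" using ln2_ge_two_thirds by linarith
  then show "1 \<le> 2 * ln x" by simp
  have "2 * (2/3) \<le> x * ln x" by (rule mult_mono) (use l assms in auto)
  then show "x * ln x \<ge> 1" by simp
  have "ln (ln x) \<le> ln x" using l ln_le_minus_one[of "ln x"] by simp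
  then show "ln (x * ln x) \<le> 2 * ln x" using l assms by (simp add: ln_mult)
qed

lemma inv_mult_log_deriv:
  fixes x :: real
  assumes "x \<ge> 2"
  shows "((\<lambda>x. 1 / (x * ln x)) has_real_derivative - (ln x + 1) / (x * ln x)^2) (at x)"
    and "\<bar>- (ln x + 1) / (x * ln x)^2\<bar> \<le> 6 / x\<^sup>2"
proof -
  note b = ln_bounds[OF assms]
  then show "((\<lambda>x. 1 / (x * ln x)) has_real_derivative - (ln x + 1) / (x * ln x)^2) (at x)"
    using assms by (auto intro!: derivative_eq_intros simp: field_simps power2_eq_square)
  have "ln x + 1 \<le> 3 * ln x" "3 * ln x \<le> 6 * (ln x)^2"
    using b by (auto simp: power2_eq_square)
  then show "\<bar>- (ln x + 1) / (x * ln x)^2\<bar> \<le> 6 / x\<^sup>2"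
  proof -
    assume l: "ln x + 1 \<le> 3 * ln x" "3 * ln x \<le> 6 * (ln x)^2"
    have "\<bar>- (ln x + 1) / (x * ln x)^2\<bar> = (ln x + 1) / (x * ln x)^2"
      using b assms by (simp add: abs_divide abs_minus_commute)
    also have "\<dots> \<le> 6 * (ln x)^2 / (x * ln x)^2"
      by (intro divide_right_mono) (use l in auto)
    also have "\<dots> = 6 / x\<^sup>2"
      using b by (auto simp: power_mult_distrib)
    finally show ?thesis .
  qed
qed

text \<open>
  With \<open>y = x ln x\<close> the derivative of \<open>f e - f 0\<close> is that of \<open>f 0\<close> times
  \<open>(1 + e) y powr (-e) - 1\<close>. That factor lies between \<open>- e ln y\<close> and \<open>e\<close>, so it costs one
  logarithm and contributes the factor \<open>e\<close>; the logarithm is absorbed by \<open>(x ln x)\<^sup>2\<close> in the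
  denominator, which leaves a summable bound.
\<close>

lemma bertrand_minus_log_deriv:
  fixes x e :: real
  assumes "x \<ge> 2" "e > 0"
  defines "y \<equiv> x * ln x"
  defines "D \<equiv> - (ln x + 1) / y\<^sup>2 * ((1 + e) * y powr (-e) - 1)"
  shows "((\<lambda>x. 1 / (x * ln x) powr (1 + e) - 1 / (x * ln x)) has_real_derivative D) (at x)"
    and "\<bar>D\<bar> \<le> 6 * e / x\<^sup>2"
proof -
  note b = ln_bounds[OF assms(1)]
  have y: "y \<ge> 1" using b by (simp add: y_def)
  have [simp]: "x > 0" "ln x > 0" using assms b by auto
  have p: "y powr (- 1 - e - 1) = y powr (-e) / y^2"
  proof -
    have "- 1 - e - 1 = - e - 2" by simp
    then have "y powr (- 1 - e - 1) = y powr (-e - 2)" by (rule arg_cong)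
    also have "\<dots> = y powr (-e) / y powr 2" by (rule powr_diff)
    finally show ?thesis using y by simp
  qed
  have "((\<lambda>x. (x * ln x) powr (- 1 - e) - 1 / (x * ln x)) has_real_derivative D) (at x)"
  proof (rule DERIV_cong)
    have "((\<lambda>x. x * ln x) has_real_derivative (ln x + 1)) (at x)"
      using assms by (auto intro!: derivative_eq_intros)
    from DERIV_diff[OF DERIV_fun_powr[OF this, of "-1 - e"] inv_mult_log_deriv(1)[OF assms(1)]]
    show "((\<lambda>x. (x * ln x) powr (- 1 - e) - 1 / (x * ln x)) has_real_derivative
        (-1 - e) * y powr (-1 - e - 1) * (ln x + 1) - - (ln x + 1) / y^2) (at x)"
      by (simp add: y_def)
    show "(-1 - e) * y powr (-1 - e - 1) * (ln x + 1) - - (ln x + 1) / y^2 = D"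
      unfolding p D_def by (simp add: field_simps add_divide_distrib diff_divide_distrib)
  qed
  then show "((\<lambda>x. 1 / (x * ln x) powr (1 + e) - 1 / (x * ln x)) has_real_derivative D) (at x)"
    by (simp add: powr_minus[symmetric] divide_inverse)
  have pw: "y powr (-e) = exp (- (e * ln y))" using y by (simp add: powr_def)
  have ly: "ln y \<ge> 0" using y by simp
  have lo: "1 - e * ln y \<le> y powr (-e)" using exp_ge_add_one_self[of "- (e * ln y)"] by (simp add: pw)
  have hi: "y powr (-e) \<le> 1" using ly assms(2) unfolding pw by simp
  have A: "\<bar>(1 + e) * y powr (-e) - 1\<bar> \<le> e * (2 * ln x)"
  proof (rule abs_leI)
    have "(1 + e) * y powr (-e) - 1 \<le> (1 + e) * 1 - 1"
      by (intro diff_right_mono mult_left_mono hi) (use assms(2) in simp)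
    also have "\<dots> = e * 1" by simp
    also have "\<dots> \<le> e * (2 * ln x)"
      by (intro mult_left_mono) (use b assms(2) in auto)
    finally show "(1 + e) * y powr (-e) - 1 \<le> e * (2 * ln x)" .
    have "0 \<le> e * y powr (-e)" using assms(2) by simp
    moreover have "- ((1 + e) * y powr (-e) - 1) = 1 - y powr (-e) - e * y powr (-e)"
      by (simp add: algebra_simps)
    ultimately have "- ((1 + e) * y powr (-e) - 1) \<le> e * ln y"
      using lo by linarith
    also have "\<dots> \<le> e * (2 * ln x)"
      by (intro mult_left_mono) (use b assms(2) in \<open>auto simp: y_def\<close>)
    finally show "- ((1 + e) * y powr (-e) - 1) \<le> e * (2 * ln x)" .
  qed
  have "\<bar>- ln x - 1\<bar> = ln x + 1" using \<open>ln x > 0\<close> by linarith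
  then have "\<bar>D\<bar> = (ln x + 1) / y\<^sup>2 * \<bar>(1 + e) * y powr (-e) - 1\<bar>"
    by (simp add: D_def abs_mult)
  also have "\<dots> \<le> (3 * ln x) / y\<^sup>2 * (e * (2 * ln x))"
    by (intro mult_mono divide_right_mono divide_nonneg_nonneg A) (use b assms(1) in auto)
  also have "\<dots> = 6 * e / x\<^sup>2"
    using assms(1) by (simp add: y_def power2_eq_square field_simps)
  finally show "\<bar>D\<bar> \<le> 6 * e / x\<^sup>2" .
qed

section \<open>The antiderivative via the incomplete Gamma function\<close>

definition lower_Gamma :: "real \<Rightarrow> real \<Rightarrow> real" where
  "lower_Gamma a T = integral {0..T} (\<lambda>t. t powr (a - 1) / exp t)"

lemma lower_Gamma_deriv:
  assumes "a > 0" "T > 0"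
  shows "(lower_Gamma a has_real_derivative T powr (a - 1) / exp T) (at T)"
proof -
  let ?f = "\<lambda>t::real. t powr (a - 1) / exp t"
  have "?f integrable_on {0..}"
    using Gamma_integral_real[OF assms(1)] by blast
  then have "?f integrable_on {0..T+1}"
    by (rule integrable_on_subinterval) auto
  moreover have cont: "continuous (at T within UNIV) ?f"
    using assms by (auto intro!: continuous_intros)
  ultimately have "((\<lambda>u. integral {0..u} ?f) has_vector_derivative ?f T) (at T within ({0..T+1}))"
    using integral_has_vector_derivative_continuous_at[of ?f 0 "T + 1" T "{}"] assms
      continuous_within_subset[OF cont] by simp
  moreover have "at T within {0..T+1} = at T"
    by (rule at_within_interior) (use assms in auto)
  ultimately show ?thesis
    by (simp add: has_real_derivative_iff_has_vector_derivative lower_Gamma_def[abs_def])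
qed

lemma lower_Gamma_tendsto:
  assumes "a > 0"
  shows "(lower_Gamma a \<longlongrightarrow> Gamma a) at_top"
proof -
  let ?f = "\<lambda>t::real. t powr (a - 1) / exp t"
  have "?f absolutely_integrable_on {0..}"
    using Gamma_integral_real[OF assms] by (intro nonnegative_absolutely_integrable_1) auto
  then have i: "set_integrable lebesgue {0..} ?f" .
  have "((\<lambda>T. set_lebesgue_integral lebesgue {0..T} ?f) \<longlongrightarrow> set_lebesgue_integral lebesgue {0..} ?f) at_top"
    by (rule tendsto_set_lebesgue_integral_at_top[OF _ i]) auto
  moreover have "set_lebesgue_integral lebesgue {0..T} ?f = lower_Gamma a T" for T
    unfolding lower_Gamma_def
    by (rule set_lebesgue_integral_eq_integral(2), rule set_integrable_subset[OF i]) auto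
  moreover have "set_lebesgue_integral lebesgue {0..} ?f = Gamma a"
    using set_lebesgue_integral_eq_integral(2)[OF i] Gamma_integral_real[OF assms]
    by (simp add: integral_unique)
  ultimately show ?thesis by simp
qed

text \<open>
  The integrand lies between \<open>exp (-T)\<close> and \<open>1\<close> times \<open>t powr (a - 1)\<close>, so for small \<open>T\<close> the two
  bounds agree to leading order.
\<close>

lemma lower_Gamma_bounds:
  assumes "a > 0" "T \<ge> 0"
  shows "exp (-T) * (T powr a / a) \<le> lower_Gamma a T" "lower_Gamma a T \<le> T powr a / a"
proof -
  let ?f = "\<lambda>t::real. t powr (a - 1) / exp t"
  have p: "((\<lambda>t. t powr (a - 1)) has_integral (T powr a / a)) {0..T}"
    using has_integral_powr_from_0[of "a - 1" T] assms by simp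
  have "?f integrable_on {0..}"
    using Gamma_integral_real[OF assms(1)] by blast
  then have "?f integrable_on {0..T}"
    by (rule integrable_on_subinterval) auto
  then have i: "(?f has_integral lower_Gamma a T) {0..T}"
    by (simp add: lower_Gamma_def integrable_integral)
  show "lower_Gamma a T \<le> T powr a / a"
    by (rule has_integral_le[OF i p])
       (use frac_le[of "t powr (a - 1)" "t powr (a - 1)" 1 "exp t" for t :: real] in auto)
  show "exp (-T) * (T powr a / a) \<le> lower_Gamma a T"
  proof (rule has_integral_le[OF has_integral_mult_right[OF p] i])
    fix x :: real assume "x \<in> {0..T}"
    then have "exp (- T) * x powr (a - 1) \<le> exp (- x) * x powr (a - 1)"
      by (intro mult_right_mono) auto
    then show "exp (- T) * x powr (a - 1) \<le> x powr (a - 1) / exp x"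
      by (simp add: exp_minus divide_inverse mult.commute)
  qed
qed

text \<open>
  Since \<open>((x ln x) powr (-e))' = - e ((x ln x) powr (-1-e) + x powr (-1-e) (ln x) powr (-e))\<close>, the
  first term is an antiderivative up to \<open>\<integral> x powr (-1-e) (ln x) powr (-e) dx\<close>, which the
  substitution \<open>t = e ln x\<close> turns into the incomplete Gamma integral of the second term.
\<close>

definition antideriv :: "real \<Rightarrow> real \<Rightarrow> real" where
  "antideriv e x = - ((x * ln x) powr (-e)) / e - e powr (e - 1) * lower_Gamma (1 - e) (e * ln x)"

lemma antideriv_deriv:
  fixes x e :: real
  assumes "x > 1" "0 < e" "e < 1"
  shows "(antideriv e has_real_derivative 1 / (x * ln x) powr (1 + e)) (at x)"
proof -
  have l: "ln x > 0" using assms by simp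
  have 1: "((\<lambda>x. lower_Gamma (1 - e) (e * ln x)) has_real_derivative
      (e * ln x) powr (- e) / exp (e * ln x) * (e / x)) (at x)"
  proof (rule DERIV_chain2[where f = "lower_Gamma (1 - e)"])
    show "(lower_Gamma (1 - e) has_real_derivative (e * ln x) powr (- e) / exp (e * ln x)) (at (e * ln x))"
      using lower_Gamma_deriv[of "1 - e" "e * ln x"] assms l by simp
    show "((\<lambda>x. e * ln x) has_real_derivative e / x) (at x)"
      using assms by (auto intro!: derivative_eq_intros)
  qed
  have ex: "exp (e * ln x) = x powr e" using assms by (simp add: powr_def)
  show ?thesis
  proof (rule DERIV_cong)
    have "((\<lambda>x. x * ln x) has_real_derivative (ln x + 1)) (at x)"
      using assms by (auto intro!: derivative_eq_intros)
    from DERIV_diff[OF DERIV_cdivide[OF DERIV_minus[OF DERIV_fun_powr[OF this, of "- e"]], where c = e]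
        DERIV_cmult[OF 1, where c = "e powr (e - 1)"]]
    show "(antideriv e has_real_derivative
        - (- e * (x * ln x) powr (- e - 1) * (ln x + 1)) / e
        - e powr (e - 1) * ((e * ln x) powr (- e) / exp (e * ln x) * (e / x))) (at x)"
      using assms l unfolding antideriv_def[abs_def] by simp
    let ?p = "(x * ln x) powr (- e)"
    have "e powr (e - 1) * ((e * ln x) powr (- e) / exp (e * ln x) * (e / x))
        = (e powr (e - 1) * e powr (- e) * e) * (ln x powr (- e) * (1 / x powr e)) / x"
      using assms l by (simp add: ex powr_mult)
    also have "e powr (e - 1) * e powr (- e) * e = 1"
    proof -
      have "e powr (e - 1) * e powr (- e) = e powr (- 1)" using powr_add[of e "e - 1" "- e"] by simp
      then show ?thesis using assms by (simp add: powr_minus_divide)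
    qed
    also have "ln x powr (- e) * (1 / x powr e) = ?p"
      using assms l by (simp add: powr_mult powr_minus divide_inverse)
    finally have 2: "e powr (e - 1) * ((e * ln x) powr (- e) / exp (e * ln x) * (e / x)) = ?p / x"
      by simp
    have 3: "(x * ln x) powr (- e - 1) = ?p / (x * ln x)"
      using assms l by (simp add: powr_diff)
    have 4: "1 / (x * ln x) powr (1 + e) = ?p / (x * ln x)"
      using assms l by (simp add: powr_add powr_minus divide_inverse)
    show "- (- e * (x * ln x) powr (- e - 1) * (ln x + 1)) / e
        - e powr (e - 1) * ((e * ln x) powr (- e) / exp (e * ln x) * (e / x))
        = 1 / (x * ln x) powr (1 + e)"
      unfolding 2 3 4 using assms l by (simp add: divide_simps) (simp add: algebra_simps)
  qed
qed

lemma antideriv_tendsto: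
  fixes e :: real
  assumes "0 < e" "e < 1"
  shows "(antideriv e \<longlongrightarrow> - (e powr (e - 1) * Gamma (1 - e))) at_top"
proof -
  have 1: "((\<lambda>x. lower_Gamma (1 - e) (e * ln x)) \<longlongrightarrow> Gamma (1 - e)) at_top"
  proof (rule filterlim_compose[OF lower_Gamma_tendsto])
    show "filterlim (\<lambda>x. e * ln x) at_top at_top" using assms by real_asymp
  qed (use assms in simp)
  have 2: "((\<lambda>x. - ((x * ln x) powr (-e)) / e) \<longlongrightarrow> 0) at_top"
    using assms by real_asymp
  show ?thesis
    unfolding antideriv_def[abs_def]
    using tendsto_diff[OF 2 tendsto_mult[OF tendsto_const 1]] by simp
qed

section \<open>Expansion of the integral\<close>

text \<open>
  A Taylor estimate that asks of \<open>f'\<close> only differentiability at the single point \<open>a\<close>: this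
  already makes \<open>f'\<close> Lipschitz as seen from \<open>a\<close>, and the mean value theorem does the rest.
\<close>

lemma second_order_bigo:
  fixes f f' :: "real \<Rightarrow> real"
  assumes f: "eventually (\<lambda>y. (f has_real_derivative f' y) (at y)) (nhds a)"
    and f': "(f' has_real_derivative c) (at a)"
  shows "(\<lambda>e. f (a - e) - f a + e * f' a) \<in> O[at_right 0](\<lambda>e. e\<^sup>2)"
proof -
  obtain K r where r: "r > 0" and K: "\<And>y. \<bar>y - a\<bar> < r \<Longrightarrow> \<bar>f' y - f' a\<bar> \<le> K * \<bar>y - a\<bar>"
    and d: "\<And>y. \<bar>y - a\<bar> < r \<Longrightarrow> (f has_real_derivative f' y) (at y)"
  proof -
    have "eventually (\<lambda>y. \<bar>(f' y - f' a) / (y - a)\<bar> < \<bar>c\<bar> + 1) (at a)"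
      by (rule order_tendstoD(2)[OF tendsto_rabs[OF f'[unfolded has_field_derivative_iff]]]) simp
    then obtain r1 where r1: "r1 > 0" "\<And>y. y \<noteq> a \<Longrightarrow> dist y a < r1 \<Longrightarrow> \<bar>(f' y - f' a) / (y - a)\<bar> < \<bar>c\<bar> + 1"
      unfolding eventually_at by auto
    obtain r2 where r2: "r2 > 0" "\<And>y. dist y a < r2 \<Longrightarrow> (f has_real_derivative f' y) (at y)"
      using f unfolding eventually_nhds_metric by auto
    show thesis
    proof (rule that[of "min r1 r2" "\<bar>c\<bar> + 1"])
      fix y assume y: "\<bar>y - a\<bar> < min r1 r2"
      show "(f has_real_derivative f' y) (at y)" using r2 y by (simp add: dist_real_def)
      show "\<bar>f' y - f' a\<bar> \<le> (\<bar>c\<bar> + 1) * \<bar>y - a\<bar>"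
        using r1(2)[of y] y by (cases "y = a") (auto simp: dist_real_def abs_divide field_simps)
    qed (use r1 r2 in auto)
  qed
  have K0: "K \<ge> 0"
  proof -
    have "0 \<le> \<bar>f' (a + r/2) - f' a\<bar>" by simp
    also have "\<dots> \<le> K * \<bar>r / 2\<bar>" using K[of "a + r/2"] r by simp
    finally show ?thesis using r by (simp add: zero_le_mult_iff)
  qed
  have "eventually (\<lambda>e. e \<in> {0<..<r}) (at_right 0)"
    using r by (rule eventually_at_right_real)
  then have "eventually (\<lambda>e. norm (f (a - e) - f a + e * f' a) \<le> K * norm (e\<^sup>2)) (at_right 0)"
  proof eventually_elim
    case (elim e)
    have "\<exists>z. a - e < z \<and> z < a \<and> f a - f (a - e) = (a - (a - e)) * f' z"
      by (rule MVT2) (use elim d in auto)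
    then obtain z where z: "a - e < z" "z < a" "f a - f (a - e) = e * f' z"
      by auto
    have "norm (f (a - e) - f a + e * f' a) = e * \<bar>f' z - f' a\<bar>"
    proof -
      have "f (a - e) - f a + e * f' a = - (e * (f' z - f' a))" using z(3) by (simp add: algebra_simps)
      then show ?thesis using elim by (simp add: abs_mult)
    qed
    also have "\<dots> \<le> e * (K * \<bar>z - a\<bar>)"
      using elim z by (intro mult_left_mono K) auto
    also have "\<dots> \<le> e * (K * e)"
      using elim z K0 by (intro mult_left_mono) auto
    finally show ?case using elim by (simp add: power2_eq_square mult_ac)
  qed
  then show ?thesis by (rule bigoI)
qed

lemma Gamma_expansion:
  "(\<lambda>e. Gamma (1 - e) - 1 - euler_mascheroni * e) \<in> O[at_right 0](\<lambda>e::real. e\<^sup>2)"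
proof -
  have *: "(\<lambda>e. Gamma (1 - e) - Gamma 1 + e * (Gamma 1 * Digamma 1)) \<in> O[at_right 0](\<lambda>e::real. e\<^sup>2)"
  proof (rule second_order_bigo[where f' = "\<lambda>y. Gamma y * Digamma y"])
    have "eventually (\<lambda>y. y \<in> {0<..}) (nhds (1::real))"
      by (rule eventually_nhds_in_open) auto
    then show "eventually (\<lambda>y. (Gamma has_real_derivative Gamma y * Digamma y) (at y)) (nhds (1::real))"
      by eventually_elim (auto intro!: has_field_derivative_Gamma elim!: nonpos_Ints_cases)
    show "((\<lambda>y. Gamma y * Digamma y) has_real_derivative
        (Gamma 1 * Digamma 1) * Digamma 1 + Polygamma 1 1 * Gamma 1) (at (1::real))"
      by (rule derivative_eq_intros refl | simp)+
  qed
  then show ?thesis by (simp add: Digamma_1 algebra_simps)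
qed

text \<open>
  The first two terms are the integral of \<open>f e\<close> over \<open>[2, \<infinity>)\<close>, as the limit of the antiderivative
  at infinity minus its value at \<open>2\<close>. The claim splits into four estimates: the boundary term \<open>A\<close>,
  the incomplete Gamma term \<open>B\<close>, the main term \<open>C\<close> in which \<open>Gamma (1 - e)\<close> has been replaced by
  its linear approximation, and the remainder \<open>R\<close> of that replacement. The boundary
  term and the main term have opposite poles \<open>1 / e\<close>, hence the subtraction in \<open>A\<close> and the addition
  in \<open>C\<close>.
\<close>

lemma integral_expansion:
  "(\<lambda>e. - (e powr (e - 1) * Gamma (1 - e)) - antideriv e 2 + ln (ln 2) + ln e + euler_mascheroni)
     \<in> O[at_right 0](\<lambda>e::real. e * (ln e)\<^sup>2)"
proof -
  define g :: real where "g = euler_mascheroni"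
  define b :: real where "b = ln 2"
  define r where "r = (\<lambda>e::real. Gamma (1 - e) - 1 - g * e)"
  have b: "0 < b" by (simp add: b_def)
  have A: "(\<lambda>e. ((2 * b) powr (-e) - 1) / e + b + ln b) \<in> O[at_right 0](\<lambda>e::real. e * (ln e)\<^sup>2)"
  proof -
    have "(\<lambda>e. ((2 * b) powr (-e) - 1) / e + ln (2 * b)) \<in> O[at_right 0](\<lambda>e::real. e * (ln e)\<^sup>2)"
      using b by real_asymp
    then show ?thesis using b by (simp add: ln_mult b_def add.assoc)
  qed
  have B: "(\<lambda>e. e powr (e - 1) * lower_Gamma (1 - e) (e * b) - b) \<in> O[at_right 0](\<lambda>e::real. e * (ln e)\<^sup>2)"
  proof -
    let ?u = "\<lambda>e::real. b powr (1 - e) / (1 - e) - b"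
    let ?l = "\<lambda>e::real. exp (- (e * b)) * (b powr (1 - e) / (1 - e)) - b"
    have ul: "(\<lambda>e. \<bar>?u e\<bar> + \<bar>?l e\<bar>) \<in> O[at_right 0](\<lambda>e::real. e * (ln e)\<^sup>2)"
    proof (intro sum_in_bigo)
      have "?u \<in> O[at_right 0](\<lambda>e::real. e * (ln e)\<^sup>2)" using b by real_asymp
      then show "(\<lambda>e. \<bar>?u e\<bar>) \<in> O[at_right 0](\<lambda>e::real. e * (ln e)\<^sup>2)" by simp
      have "?l \<in> O[at_right 0](\<lambda>e::real. e * (ln e)\<^sup>2)" using b by real_asymp
      then show "(\<lambda>e. \<bar>?l e\<bar>) \<in> O[at_right 0](\<lambda>e::real. e * (ln e)\<^sup>2)" by simp
    qed
    have "eventually (\<lambda>e. e \<in> {0<..<1}) (at_right (0::real))"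
      by (rule eventually_at_right_real) simp
    then have "eventually (\<lambda>e. norm (e powr (e - 1) * lower_Gamma (1 - e) (e * b) - b)
        \<le> 1 * norm (\<bar>?u e\<bar> + \<bar>?l e\<bar>)) (at_right 0)"
    proof eventually_elim
      case (elim e)
      have eq: "e powr (e - 1) * (e * b) powr (1 - e) = b powr (1 - e)"
        using elim b by (simp add: powr_mult powr_add[symmetric] mult.assoc[symmetric])
      have "e powr (e - 1) * lower_Gamma (1 - e) (e * b) \<le> e powr (e - 1) * ((e * b) powr (1 - e) / (1 - e))"
        using elim b by (intro mult_left_mono lower_Gamma_bounds) auto
      then have 1: "e powr (e - 1) * lower_Gamma (1 - e) (e * b) - b \<le> ?u e"
        using eq by simp
      have "exp (- (e * b)) * (b powr (1 - e) / (1 - e))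
          = e powr (e - 1) * (exp (- (e * b)) * ((e * b) powr (1 - e) / (1 - e)))"
        unfolding eq[symmetric] by simp
      also have "\<dots> \<le> e powr (e - 1) * lower_Gamma (1 - e) (e * b)"
        using elim b by (intro mult_left_mono lower_Gamma_bounds) auto
      finally have 2: "?l e \<le> e powr (e - 1) * lower_Gamma (1 - e) (e * b) - b" by simp
      show ?case using 1 2 unfolding real_norm_def mult_1 by linarith
    qed
    then have "(\<lambda>e. e powr (e - 1) * lower_Gamma (1 - e) (e * b) - b) \<in> O[at_right 0](\<lambda>e. \<bar>?u e\<bar> + \<bar>?l e\<bar>)"
      by (rule bigoI)
    then show ?thesis using ul by (rule landau_o.big_trans)
  qed
  have C: "(\<lambda>e. 1 / e - e powr (e - 1) * (1 + g * e) + ln e + g) \<in> O[at_right 0](\<lambda>e::real. e * (ln e)\<^sup>2)"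
    by real_asymp
  have R: "(\<lambda>e. e powr (e - 1) * r e) \<in> O[at_right 0](\<lambda>e::real. e * (ln e)\<^sup>2)"
  proof -
    have "(\<lambda>e. e powr (e - 1)) \<in> O[at_right 0](\<lambda>e::real. 1 / e)" by real_asymp
    moreover have "r \<in> O[at_right 0](\<lambda>e. e\<^sup>2)" using Gamma_expansion by (simp add: r_def g_def)
    ultimately have "(\<lambda>e. e powr (e - 1) * r e) \<in> O[at_right 0](\<lambda>e. 1 / e * e\<^sup>2)"
      by (rule landau_o.big.mult)
    moreover have "(\<lambda>e. 1 / e * e\<^sup>2) \<in> O[at_right 0](\<lambda>e::real. e * (ln e)\<^sup>2)" by real_asymp
    ultimately show ?thesis by (rule landau_o.big_trans)
  qed
  have "(\<lambda>e. (((2 * b) powr (-e) - 1) / e + b + ln b) + (e powr (e - 1) * lower_Gamma (1 - e) (e * b) - b)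
      + (1 / e - e powr (e - 1) * (1 + g * e) + ln e + g) - e powr (e - 1) * r e)
      \<in> O[at_right 0](\<lambda>e::real. e * (ln e)\<^sup>2)"
    by (intro sum_in_bigo A B C R)
  also have "(\<lambda>e. (((2 * b) powr (-e) - 1) / e + b + ln b) + (e powr (e - 1) * lower_Gamma (1 - e) (e * b) - b)
      + (1 / e - e powr (e - 1) * (1 + g * e) + ln e + g) - e powr (e - 1) * r e)
     = (\<lambda>e. - (e powr (e - 1) * Gamma (1 - e)) - antideriv e 2 + ln (ln 2) + ln e + euler_mascheroni)"
    by (rule ext) (simp add: antideriv_def r_def b_def g_def algebra_simps diff_divide_distrib)
  finally show ?thesis .
qed

section \<open>Comparing the sum with the integral\<close>

text \<open>
  The offset \<open>2\<close> is the starting point of the series; when \<open>F\<close> is an antiderivative of \<open>f\<close>, this is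
  the value of \<open>f\<close> at an integer minus its integral over the following unit interval.
\<close>

definition defect :: "(real \<Rightarrow> real) \<Rightarrow> (real \<Rightarrow> real) \<Rightarrow> nat \<Rightarrow> real" where
  "defect F f n = f (real n + 2) - (F (real n + 3) - F (real n + 2))"

lemma sum_eq_sum_defect:
  "(\<Sum>k<n. f (real k + 2)) = (\<Sum>k<n. defect F f k) + F (real n + 2) - F 2"
  by (induction n) (auto simp: defect_def add_ac)

lemma sums_from_defect:
  assumes "summable (defect F f)" and "(F \<longlongrightarrow> L) at_top"
  shows "(\<lambda>n. f (real n + 2)) sums (suminf (defect F f) + L - F 2)"
proof -
  have "(\<lambda>n. F (real n + 2)) \<longlonglongrightarrow> L"
    by (rule filterlim_compose[OF assms(2)]) real_asymp
  then show ?thesis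
    unfolding sums_def sum_eq_sum_defect[of f _ F]
    by (intro tendsto_intros summable_LIMSEQ assms)
qed

lemma summable_inverse_square_shift: "summable (\<lambda>n. 1 / (real n + 2)\<^sup>2)"
  using summable_ignore_initial_segment[OF inverse_power_summable[of 2, where 'a = real], of 2]
  by (simp add: divide_inverse add.commute)

lemma defect_le:
  assumes "\<And>x. x \<ge> 2 \<Longrightarrow> (F has_real_derivative f x) (at x)"
    and "\<And>x. x \<ge> 2 \<Longrightarrow> (f has_real_derivative f' x) (at x)"
    and "\<And>x. x \<ge> 2 \<Longrightarrow> \<bar>f' x\<bar> \<le> C / x\<^sup>2" and "C \<ge> 0"
  shows "\<bar>defect F f n\<bar> \<le> C * (1 / (real n + 2)\<^sup>2)"
proof -
  have "\<bar>f (real n + 2) - (F ((real n + 2) + 1) - F (real n + 2))\<bar> \<le> C / (real n + 2)\<^sup>2"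
  proof (rule mvt_unit_step)
    fix x assume x: "real n + 2 \<le> x"
    then have "x \<ge> 2" by simp
    note assms(1,2)[OF this]
    then show "(F has_real_derivative f x) (at x)" "(f has_real_derivative f' x) (at x)" .
    have "\<bar>f' x\<bar> \<le> C / x\<^sup>2" using assms(3) x by simp
    also have "\<dots> \<le> C / (real n + 2)\<^sup>2"
      using x assms(4) by (intro divide_left_mono power_mono) auto
    finally show "\<bar>f' x\<bar> \<le> C / (real n + 2)\<^sup>2" .
  qed
  then show ?thesis by (simp add: defect_def add_ac)
qed

abbreviation loglog :: "real \<Rightarrow> real" where "loglog x \<equiv> ln (ln x)"

lemma loglog_deriv:
  assumes "x > 1"
  shows "(loglog has_real_derivative 1 / (x * ln x)) (at x)"
  using assms by (auto intro!: derivative_eq_intros)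

lemma defect_loglog_summable: "summable (defect loglog (\<lambda>x. 1 / (x * ln x)))"
proof (rule summable_comparison_test')
  show "summable (\<lambda>n. 6 * (1 / (real n + 2)\<^sup>2))"
    by (intro summable_mult summable_inverse_square_shift)
  show "norm (defect loglog (\<lambda>x. 1 / (x * ln x)) n) \<le> 6 * (1 / (real n + 2)\<^sup>2)" for n
    unfolding real_norm_def
    by (rule defect_le) (use loglog_deriv inv_mult_log_deriv in auto)
qed

text \<open>
  The telescoping sum of \<open>ln (ln x)\<close> cancels the subtracted term of \<open>C11_seq\<close> except for its value
  at the starting point \<open>2\<close>.
\<close>

lemma C11_seq_tendsto:
  "C11_seq \<longlonglongrightarrow> suminf (defect loglog (\<lambda>x. 1 / (x * ln x))) - ln (ln 2)"
proof -
  have "C11_seq (n + 2) = (\<Sum>k<n. defect loglog (\<lambda>x. 1 / (x * ln x)) k) - ln (ln 2)" for n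
  proof -
    have "(\<Sum>k\<in>{2..<n + 2}. 1 / (real k * ln (real k))) = (\<Sum>k<n. 1 / ((real k + 2) * ln (real k + 2)))"
      by (rule sum.reindex_bij_witness[of _ "\<lambda>k. k + 2" "\<lambda>k. k - 2"]) (auto simp: of_nat_diff)
    then show ?thesis
      using sum_eq_sum_defect[of "\<lambda>x. 1 / (x * ln x)" n loglog]
      by (simp add: C11_seq_def add_ac)
  qed
  then have "(\<lambda>n. C11_seq (n + 2)) \<longlonglongrightarrow> suminf (defect loglog (\<lambda>x. 1 / (x * ln x))) - ln (ln 2)"
    using tendsto_diff[OF summable_LIMSEQ[OF defect_loglog_summable] tendsto_const] by simp
  then show ?thesis by (rule LIMSEQ_offset)
qed

text \<open>
  \<open>defect\<close> is linear in the pair \<open>(F, f)\<close>, so the difference of the two defects is the defect of the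
  differences, to which the bound on \<open>(f e - f 0)'\<close> applies.
\<close>

lemma defect_antideriv_close:
  assumes "0 < e" "e < 1"
  shows "\<bar>defect (antideriv e) (\<lambda>x. 1 / (x * ln x) powr (1 + e)) n
           - defect loglog (\<lambda>x. 1 / (x * ln x)) n\<bar> \<le> 6 * e * (1 / (real n + 2)\<^sup>2)"
proof -
  have "\<bar>defect (\<lambda>x. antideriv e x - loglog x) (\<lambda>x. 1 / (x * ln x) powr (1 + e) - 1 / (x * ln x)) n\<bar>
      \<le> 6 * e * (1 / (real n + 2)\<^sup>2)"
    by (rule defect_le)
       (use assms in \<open>auto intro!: DERIV_diff antideriv_deriv loglog_deriv bertrand_minus_log_deriv\<close>)
  then show ?thesis by (simp add: defect_def algebra_simps)
qed

lemma bertrand_sums: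
  assumes e: "0 < e" "e < 1"
  shows "summable (defect (antideriv e) (\<lambda>x. 1 / (x * ln x) powr (1 + e)))"
    and "(\<lambda>n. bertrand_term (1 + e) (n + 2)) sums
      (suminf (defect (antideriv e) (\<lambda>x. 1 / (x * ln x) powr (1 + e)))
        - e powr (e - 1) * Gamma (1 - e) - antideriv e 2)"
proof -
  let ?d = "defect (antideriv e) (\<lambda>x. 1 / (x * ln x) powr (1 + e))"
  let ?d1 = "defect loglog (\<lambda>x. 1 / (x * ln x))"
  have "summable (\<lambda>n. ?d n - ?d1 n)"
  proof (rule summable_comparison_test')
    show "summable (\<lambda>n. 6 * e * (1 / (real n + 2)\<^sup>2))"
      by (intro summable_mult summable_inverse_square_shift)
    show "norm (?d n - ?d1 n) \<le> 6 * e * (1 / (real n + 2)\<^sup>2)" for n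
      unfolding real_norm_def by (rule defect_antideriv_close[OF e])
  qed
  from summable_add[OF this defect_loglog_summable] show s: "summable ?d" by simp
  from sums_from_defect[OF this antideriv_tendsto[OF e]]
  show "(\<lambda>n. bertrand_term (1 + e) (n + 2)) sums
      (suminf ?d - e powr (e - 1) * Gamma (1 - e) - antideriv e 2)"
    by (simp add: bertrand_term_def add_ac)
qed

text \<open>
  The antiderivative is available only for exponents below \<open>2\<close>, where \<open>Gamma (1 - e)\<close> is an
  integral. As \<open>x ln x \<ge> 1\<close>, a larger exponent gives smaller terms.
\<close>

lemma bertrand_summable:
  assumes "s > 1"
  shows "summable (\<lambda>n. bertrand_term s (n + 2))"
proof (rule summable_comparison_test')
  define e where "e = min (s - 1) (1/2)"
  have e: "0 < e" "e < 1" "1 + e \<le> s" using assms by (auto simp: e_def)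
  show "summable (\<lambda>n. bertrand_term (1 + e) (n + 2))"
    using bertrand_sums(2)[OF e(1,2)] by (rule sums_summable)
  fix n :: nat
  have y: "real (n + 2) * ln (real (n + 2)) \<ge> 1" by (rule ln_bounds) simp
  then have "(real (n + 2) * ln (real (n + 2))) powr (1 + e) \<le> (real (n + 2) * ln (real (n + 2))) powr s"
    using e by (intro powr_mono) auto
  moreover have "(real (n + 2) * ln (real (n + 2))) powr (1 + e) > 0"
    using y by simp
  ultimately show "norm (bertrand_term s (n + 2)) \<le> bertrand_term (1 + e) (n + 2)"
    unfolding bertrand_term_def by (simp add: frac_le del: of_nat_add)
qed

theorem mainTheorem17:
  "convergent C11_seq \<and>
   (\<forall>s>1. summable (\<lambda>n. bertrand_term s (n + 2))) \<and>
   (\<lambda>s. (\<Sum>n. bertrand_term s (n + 2)) - (- ln (s - 1) + C11 - euler_mascheroni))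
     \<in> O[at_right 1](\<lambda>s. (s - 1) * (ln (s - 1))\<^sup>2)"
proof (intro conjI allI impI)
  show "convergent C11_seq" using C11_seq_tendsto by (rule convergentI)
  show "summable (\<lambda>n. bertrand_term s (n + 2))" if "s > 1" for s
    using that by (rule bertrand_summable)
  define d1 where "d1 = defect loglog (\<lambda>x. 1 / (x * ln x))"
  define d where "d = (\<lambda>e. defect (antideriv e) (\<lambda>x. 1 / (x * ln x) powr (1 + e)))"
  define K where "K = (\<Sum>n. 1 / (real n + 2)\<^sup>2)"
  have C11: "C11 = suminf d1 - ln (ln 2)"
    unfolding C11_def d1_def by (rule limI[OF C11_seq_tendsto])
  have small: "eventually (\<lambda>e. e \<in> {0<..<1}) (at_right (0::real))"
    by (rule eventually_at_right_real) simp
  from small have "eventually (\<lambda>e. norm (suminf (d e) - suminf d1) \<le> (6 * K) * norm e) (at_right 0)"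
  proof eventually_elim
    case (elim e)
    then have e: "0 < e" "e < 1" by auto
    have le: "norm (d e n - d1 n) \<le> 6 * e * (1 / (real n + 2)\<^sup>2)" for n
      unfolding real_norm_def d_def d1_def by (rule defect_antideriv_close[OF e])
    have "suminf (d e) - suminf d1 = (\<Sum>n. d e n - d1 n)"
      unfolding d_def d1_def by (intro suminf_diff bertrand_sums(1) defect_loglog_summable e)
    also have "norm \<dots> \<le> (\<Sum>n. 6 * e * (1 / (real n + 2)\<^sup>2))"
      by (intro norm_suminf_le le summable_mult summable_inverse_square_shift)
    also have "\<dots> = 6 * e * K"
      unfolding K_def by (rule suminf_mult[OF summable_inverse_square_shift])
    finally show ?case using e by (simp add: mult_ac)
  qed
  then have "(\<lambda>e. suminf (d e) - suminf d1) \<in> O[at_right 0](\<lambda>e. e)"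
    by (rule bigoI)
  also have "(\<lambda>e. e) \<in> O[at_right 0](\<lambda>e::real. e * (ln e)\<^sup>2)" by real_asymp
  finally have "(\<lambda>e. (suminf (d e) - suminf d1) +
      (- (e powr (e - 1) * Gamma (1 - e)) - antideriv e 2 + ln (ln 2) + ln e + euler_mascheroni))
      \<in> O[at_right 0](\<lambda>e. e * (ln e)\<^sup>2)"
    by (rule sum_in_bigo(1)) (rule integral_expansion)
  also have "?this \<longleftrightarrow> (\<lambda>e. (\<Sum>n. bertrand_term (1 + e) (n + 2)) - (- ln e + C11 - euler_mascheroni))
      \<in> O[at_right 0](\<lambda>e. e * (ln e)\<^sup>2)"
  proof (rule landau_o.big.in_cong)
    from small show "eventually (\<lambda>e. (suminf (d e) - suminf d1) +
      (- (e powr (e - 1) * Gamma (1 - e)) - antideriv e 2 + ln (ln 2) + ln e + euler_mascheroni)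
      = (\<Sum>n. bertrand_term (1 + e) (n + 2)) - (- ln e + C11 - euler_mascheroni)) (at_right 0)"
    proof eventually_elim
      case (elim e)
      then have "(\<Sum>n. bertrand_term (1 + e) (n + 2))
          = suminf (d e) - e powr (e - 1) * Gamma (1 - e) - antideriv e 2"
        unfolding d_def by (intro sums_unique[symmetric] bertrand_sums(2)) auto
      then show ?case by (simp add: C11)
    qed
  qed
  finally show "(\<lambda>s. (\<Sum>n. bertrand_term s (n + 2)) - (- ln (s - 1) + C11 - euler_mascheroni))
     \<in> O[at_right 1](\<lambda>s. (s - 1) * (ln (s - 1))\<^sup>2)"
    by (subst at_right_to_0) (simp add: landau_o.big.in_filtermap_iff add.commute)
qed

end
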